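(* Let the snapshot space be $V=V^{no\_DQ}$ (difference quotients not included), and let $X^r=\mathrm{span}\{\varphi_1,\dots,\varphi_r\}$, $r\le d$, be the corresponding POD space. Let $u$ be the solution of the weak formulation of the heat equation, $u_r$ the solution of the POD Galerkin reduced order model, $P_r(u)$ the $L^2$ projection of $u$ onto $X^r$, $\eta^{L^2}:=u-P_r(u)$ and $\phi_r:=u_r-P_r(u)$. Then $$\frac{d}{dt}\|\phi_r\|^2\le\nu\,\|\nabla\eta^{L^2}\|^2 .$$
   Context: Let $\Omega$ be the computational domain and $X:=H_0^1(\Omega)$; $(\cdot,\cdot)$ and $\|\cdot\|$ denote the $L^2(\Omega)$ inner product and norm, and a subscript $t$ denotes the time derivative. Let $u(\cdot,t)\in X$, $t\in[0,T]$, be the weak solution of the heat equation with diffusion coefficient $\nu$ and forcing $f$: $(u_t,v)+\nu(\nabla u,\nabla v)=(f,v)$ for all $v\in X$. Snapshots and POD: given time instances $t_0,\dots,t_N\in[0,T]$, set $V^{no\_DQ}:=\mathrm{span}\{u(\cdot,t_0),\dots,u(\cdot,t_N)\}$. Write $s_1,\dots,s_M$, $M=N+1$, for these spanning functions and $d=\dim V^{no\_DQ}$. The POD basis $\{\varphi_1,\dots,\varphi_r\}$, $r\le d$, minimizes $\frac1M\sum_{i=1}^M\|s_i-\sum_{j=1}^r(s_i,\varphi_j)\varphi_j\|^2$ subject to $(\varphi_i,\varphi_j)=\delta_{ij}$, $1\le i,j\le r$. It is given by $\varphi_k=\lambda_k^{-1/2}\sum_{j=1}^M(v_k)_j s_j$,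 where $\lambda_1\ge\dots\ge\lambda_d>0$ are the positive eigenvalues and $v_1,\dots,v_d$ the associated eigenvectors of the snapshot correlation matrix $K\in\mathbb{R}^{M\times M}$, $K_{ij}=\frac1M(s_j,s_i)$. Reduced order model: $u_r(\cdot,t)\in X^r$ satisfies $(u_{r,t},v_r)+\nu(\nabla u_r,\nabla v_r)=(f,v_r)$ for all $v_r\in X^r$. $L^2$ projection: $P_r(u)\in X^r$ is defined by $(u-P_r(u),v_r)=0$ for all $v_r\in X^r$. *)

theory Defs
  imports "HOL-Analysis.Analysis"
begin

section \<open>The Hilbert space of square integrable functions\<close>

definition square_integrable :: "('a::euclidean_space \<Rightarrow> real) \<Rightarrow> bool" where
  "square_integrable f \<longleftrightarrow>
     f \<in> borel_measurable lborel \<and> integrable lborel (\<lambda>x. (f x)\<^sup>2)"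

definition l2_rel :: "('a::euclidean_space \<Rightarrow> real) \<Rightarrow> ('a \<Rightarrow> real) \<Rightarrow> bool" where
  "l2_rel f g \<longleftrightarrow>
     square_integrable f \<and> square_integrable g \<and> (AE x in lborel. f x = g x)"

lemma square_integrable_zero: "square_integrable (\<lambda>x. 0)"
  by (simp add: square_integrable_def)

lemma square_integrable_scale:
  "square_integrable f \<Longrightarrow> square_integrable (\<lambda>x. c * f x)"
  by (auto simp: square_integrable_def power_mult_distrib)

lemma square_integrable_mult:
  assumes "square_integrable f" "square_integrable g"
  shows "integrable lborel (\<lambda>x. f x * g x)"
proof (rule Bochner_Integration.integrable_bound)
  show "integrable lborel (\<lambda>x. (f x)\<^sup>2 + (g x)\<^sup>2)"
    using assms by (simp add: square_integrable_def)
  show "(\<lambda>x. f x * g x) \<in> borel_measurable lborel"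
    using assms by (auto simp: square_integrable_def)
  have "\<bar>a * b\<bar> \<le> a\<^sup>2 + b\<^sup>2" for a b :: real
  proof -
    have "2 * (\<bar>a\<bar> * \<bar>b\<bar>) \<le> a\<^sup>2 + b\<^sup>2"
      using sum_squares_bound[of "\<bar>a\<bar>" "\<bar>b\<bar>"] by (simp add: mult.assoc)
    moreover have "0 \<le> \<bar>a\<bar> * \<bar>b\<bar>" by simp
    ultimately show ?thesis unfolding abs_mult by linarith
  qed
  then show "AE x in lborel. norm (f x * g x) \<le> norm ((f x)\<^sup>2 + (g x)\<^sup>2)"
    by simp
qed

lemma square_integrable_add:
  assumes "square_integrable f" "square_integrable g"
  shows "square_integrable (\<lambda>x. f x + g x)"
  using assms square_integrable_mult[OF assms]
  by (auto simp: square_integrable_def power2_sum mult.assoc)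

lemma square_integrable_minus:
  "square_integrable f \<Longrightarrow> square_integrable (\<lambda>x. - f x)"
  by (auto simp: square_integrable_def)

lemma square_integrable_diff:
  "square_integrable f \<Longrightarrow> square_integrable g \<Longrightarrow> square_integrable (\<lambda>x. f x - g x)"
  using square_integrable_add[OF _ square_integrable_minus, of f g] by simp

lemma l2_rel_refl_iff: "l2_rel f f \<longleftrightarrow> square_integrable f"
  by (simp add: l2_rel_def)

lemma part_equivp_l2_rel: "part_equivp l2_rel"
proof (rule part_equivpI)
  show "\<exists>f. l2_rel f f"
    using square_integrable_zero l2_rel_refl_iff by blast
  show "symp l2_rel"
    by (rule sympI) (auto simp: l2_rel_def elim: AE_mp)
  show "transp l2_rel"
    by (rule transpI) (auto simp: l2_rel_def elim: AE_mp)
qed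

quotient_type (overloaded) 'a L2 = "'a::euclidean_space \<Rightarrow> real" / partial: l2_rel
  by (rule part_equivp_l2_rel)

instantiation L2 :: (euclidean_space) real_inner
begin

lift_definition zero_L2 :: "'a L2" is "\<lambda>x. 0"
  by (simp add: l2_rel_refl_iff square_integrable_zero)

lift_definition plus_L2 :: "'a L2 \<Rightarrow> 'a L2 \<Rightarrow> 'a L2" is "\<lambda>f g x. f x + g x"
  by (auto simp: l2_rel_def square_integrable_add elim!: AE_mp)

lift_definition scaleR_L2 :: "real \<Rightarrow> 'a L2 \<Rightarrow> 'a L2" is "\<lambda>c f x. c * f x"
  by (auto simp: l2_rel_def square_integrable_scale elim!: AE_mp)

lift_definition uminus_L2 :: "'a L2 \<Rightarrow> 'a L2" is "\<lambda>f x. - f x"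
  by (auto simp: l2_rel_def square_integrable_minus elim!: AE_mp)

lift_definition minus_L2 :: "'a L2 \<Rightarrow> 'a L2 \<Rightarrow> 'a L2" is "\<lambda>f g x. f x - g x"
  by (auto simp: l2_rel_def square_integrable_diff elim!: AE_mp)

lift_definition inner_L2 :: "'a L2 \<Rightarrow> 'a L2 \<Rightarrow> real" is "\<lambda>f g. \<integral>x. f x * g x \<partial>lborel"
proof -
  fix f f' g g' :: "'a \<Rightarrow> real"
  assume "l2_rel f f'" "l2_rel g g'"
  then show "(\<integral>x. f x * g x \<partial>lborel) = (\<integral>x. f' x * g' x \<partial>lborel)"
    by (intro integral_cong_AE) (auto simp: l2_rel_def square_integrable_def elim!: AE_mp)
qed

definition norm_L2_def: "norm (v :: 'a L2) = sqrt (inner v v)"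

definition dist_L2_def: "dist v (w :: 'a L2) = norm (v - w)"

definition sgn_L2_def: "sgn (v :: 'a L2) = inverse (norm v) *\<^sub>R v"

definition uniformity_L2_def [code del]:
  "(uniformity :: ('a L2 \<times> 'a L2) filter) = (INF e\<in>{0 <..}. principal {(x, y). dist x y < e})"

definition open_L2_def [code del]:
  "open (U :: 'a L2 set) \<longleftrightarrow> (\<forall>x\<in>U. eventually (\<lambda>(x', y). x' = x \<longrightarrow> y \<in> U) uniformity)"

instance
proof
  fix u v w :: "'a L2" and a b :: real
  show "u + v + w = u + (v + w)"
    by transfer (auto simp: l2_rel_def square_integrable_add add.assoc)
  show "u + v = v + u"
    by transfer (auto simp: l2_rel_def square_integrable_add add.commute)
  show "0 + u = u"
    by transfer (auto simp: l2_rel_def)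
  show "- u + u = 0"
    by transfer (auto simp: l2_rel_def square_integrable_zero)
  show "u - v = u + - v"
    by transfer (auto simp: l2_rel_def square_integrable_diff)
  show "a *\<^sub>R (u + v) = a *\<^sub>R u + a *\<^sub>R v"
    by transfer
      (auto simp: l2_rel_def algebra_simps intro!: square_integrable_add square_integrable_scale)
  show "(a + b) *\<^sub>R u = a *\<^sub>R u + b *\<^sub>R u"
    by transfer
      (auto simp: l2_rel_def algebra_simps intro!: square_integrable_add square_integrable_scale)
  show "a *\<^sub>R b *\<^sub>R u = (a * b) *\<^sub>R u"
    by transfer (auto simp: l2_rel_def mult.assoc intro!: square_integrable_scale)
  show "1 *\<^sub>R u = u"
    by transfer (auto simp: l2_rel_def)
  show "inner u v = inner v u"
    by transfer (simp add: mult.commute)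
  show "inner (u + v) w = inner u w + inner v w"
    by transfer (simp add: distrib_right square_integrable_mult l2_rel_refl_iff)
  show "inner (a *\<^sub>R u) v = a * inner u v"
    by transfer (simp add: mult.assoc)
  show "0 \<le> inner u u"
    by transfer simp
  show "inner u u = 0 \<longleftrightarrow> u = 0"
  proof transfer
    fix f :: "'a \<Rightarrow> real" assume "l2_rel f f"
    then have f: "square_integrable f" by (simp add: l2_rel_refl_iff)
    have "(\<integral>x. f x * f x \<partial>lborel) = 0 \<longleftrightarrow> (AE x in lborel. f x * f x = 0)"
      by (rule integral_nonneg_eq_0_iff_AE) (auto intro: square_integrable_mult f)
    then show "(\<integral>x. f x * f x \<partial>lborel) = 0 \<longleftrightarrow> l2_rel f (\<lambda>x. 0)"
      by (simp add: l2_rel_def f square_integrable_zero)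
  qed
qed (rule norm_L2_def dist_L2_def sgn_L2_def uniformity_L2_def open_L2_def)+

end

text \<open>\<open>L2_on \<Omega>\<close> is \<open>L\<^sup>2(\<Omega>)\<close>, each function being identified with its extension by zero; on it
  \<^const>\<open>inner\<close> and \<^const>\<open>norm\<close> are the \<open>L\<^sup>2(\<Omega>)\<close> inner product and norm.\<close>

lift_definition zero_outside :: "'a::euclidean_space set \<Rightarrow> 'a L2 \<Rightarrow> bool"
  is "\<lambda>\<Omega> f. AE x in lborel. x \<notin> \<Omega> \<longrightarrow> f x = 0"
  by (auto simp: l2_rel_def elim: AE_mp)

definition L2_on :: "'a::euclidean_space set \<Rightarrow> 'a L2 set" where
  "L2_on \<Omega> = {v. zero_outside \<Omega> v}"


section \<open>The Sobolev space of functions with zero trace\<close>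

primrec times_differentiable :: "nat \<Rightarrow> ('a::euclidean_space \<Rightarrow> real) \<Rightarrow> bool" where
  "times_differentiable 0 f \<longleftrightarrow> continuous_on UNIV f"
| "times_differentiable (Suc n) f \<longleftrightarrow>
     (\<forall>x. f differentiable (at x)) \<and>
     (\<forall>h. times_differentiable n (\<lambda>x. frechet_derivative f (at x) h))"

definition test_functions :: "'a::euclidean_space set \<Rightarrow> ('a \<Rightarrow> real) set" where
  "test_functions \<Omega> = {\<psi>. (\<forall>n. times_differentiable n \<psi>) \<and>
     compact (closure {x. \<psi> x \<noteq> 0}) \<and> closure {x. \<psi> x \<noteq> 0} \<subseteq> \<Omega>}"

text \<open>\<open>abs_L2 \<psi>\<close> is the class of a square integrable function \<open>\<psi>\<close>, so this is
  \<open>\<integral>\<^sub>\<Omega> v \<partial>\<^sub>i\<psi> = - \<integral>\<^sub>\<Omega> g \<psi>\<close>.\<close>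

definition is_weak_partial ::
  "'a::euclidean_space set \<Rightarrow> 'a L2 \<Rightarrow> 'a \<Rightarrow> 'a L2 \<Rightarrow> bool" where
  "is_weak_partial \<Omega> v i g \<longleftrightarrow> g \<in> L2_on \<Omega> \<and>
     (\<forall>\<psi>\<in>test_functions \<Omega>.
        inner v (abs_L2 (\<lambda>x. frechet_derivative \<psi> (at x) i)) = - inner g (abs_L2 \<psi>))"

definition weak_partial :: "'a::euclidean_space set \<Rightarrow> 'a L2 \<Rightarrow> 'a \<Rightarrow> 'a L2" where
  "weak_partial \<Omega> v i = (THE g. is_weak_partial \<Omega> v i g)"

definition grad_inner :: "'a::euclidean_space set \<Rightarrow> 'a L2 \<Rightarrow> 'a L2 \<Rightarrow> real" where
  "grad_inner \<Omega> v w = (\<Sum>i\<in>Basis. inner (weak_partial \<Omega> v i) (weak_partial \<Omega> w i))"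

definition grad_norm :: "'a::euclidean_space set \<Rightarrow> 'a L2 \<Rightarrow> real" where
  "grad_norm \<Omega> v = sqrt (grad_inner \<Omega> v v)"

definition H1 :: "'a::euclidean_space set \<Rightarrow> 'a L2 set" where
  "H1 \<Omega> = {v \<in> L2_on \<Omega>. \<forall>i\<in>Basis. \<exists>g. is_weak_partial \<Omega> v i g}"

definition H1_norm :: "'a::euclidean_space set \<Rightarrow> 'a L2 \<Rightarrow> real" where
  "H1_norm \<Omega> v = sqrt ((norm v)\<^sup>2 + (grad_norm \<Omega> v)\<^sup>2)"

definition H10 :: "'a::euclidean_space set \<Rightarrow> 'a L2 set" where
  "H10 \<Omega> = {v \<in> H1 \<Omega>. \<forall>\<epsilon>>0. \<exists>\<psi>\<in>test_functions \<Omega>. H1_norm \<Omega> (v - abs_L2 \<psi>) < \<epsilon>}"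


section \<open>Heat equation, POD and the Galerkin reduced order model\<close>

text \<open>The weak formulation with trial and test space \<open>W\<close>. The number \<open>D\<close> is the pairing
  \<open>(w\<^sub>t(t), v)\<close>: the time derivative of a weak solution need only exist as a functional on the
  test space, and if it exists in \<open>L\<^sup>2(\<Omega>)\<close> then \<open>D\<close> is its inner product with \<open>v\<close>. At the end
  points of \<open>[0,T]\<close> the derivative is one-sided.\<close>

definition heat_solution_in ::
  "'a::euclidean_space L2 set \<Rightarrow> 'a set \<Rightarrow> real \<Rightarrow> real \<Rightarrow> (real \<Rightarrow> 'a L2) \<Rightarrow> (real \<Rightarrow> 'a L2) \<Rightarrow> bool"
where
  "heat_solution_in W \<Omega> T \<nu> f w \<longleftrightarrow>
     (\<forall>t\<in>{0..T}. w t \<in> W \<and>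
        (\<forall>v\<in>W. \<exists>D. ((\<lambda>s. inner (w s) v) has_real_derivative D) (at t within {0..T}) \<and>
           D + \<nu> * grad_inner \<Omega> (w t) v = inner (f t) v))"

abbreviation heat_weak_solution where
  "heat_weak_solution \<Omega> \<equiv> heat_solution_in (H10 \<Omega>) \<Omega>"

definition orthonormal_family :: "nat \<Rightarrow> (nat \<Rightarrow> 'b::real_inner) \<Rightarrow> bool" where
  "orthonormal_family r \<phi> \<longleftrightarrow>
     (\<forall>i\<in>{1..r}. \<forall>j\<in>{1..r}. inner (\<phi> i) (\<phi> j) = (if i = j then 1 else 0))"

definition POD_error :: "nat \<Rightarrow> (nat \<Rightarrow> 'b::real_inner) \<Rightarrow> nat \<Rightarrow> (nat \<Rightarrow> 'b) \<Rightarrow> real" where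
  "POD_error M s r \<phi> =
     1 / real M * (\<Sum>i=1..M. (norm (s i - (\<Sum>j=1..r. inner (s i) (\<phi> j) *\<^sub>R \<phi> j)))\<^sup>2)"

definition is_POD_basis ::
  "'a::euclidean_space set \<Rightarrow> nat \<Rightarrow> (nat \<Rightarrow> 'a L2) \<Rightarrow> nat \<Rightarrow> (nat \<Rightarrow> 'a L2) \<Rightarrow> bool" where
  "is_POD_basis \<Omega> M s r \<phi> \<longleftrightarrow>
     \<phi> ` {1..r} \<subseteq> L2_on \<Omega> \<and> orthonormal_family r \<phi> \<and>
     (\<forall>\<psi>. \<psi> ` {1..r} \<subseteq> L2_on \<Omega> \<and> orthonormal_family r \<psi> \<longrightarrow>
        POD_error M s r \<phi> \<le> POD_error M s r \<psi>)"

definition L2_projection :: "'b::real_inner set \<Rightarrow> 'b \<Rightarrow> 'b" where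
  "L2_projection W u = (THE p. p \<in> W \<and> (\<forall>v\<in>W. inner (u - p) v = 0))"

end

theory Submission
  imports Defs
begin

text \<open>Since \<open>r \<le> dim V\<close>, a minimiser of the POD error lies in the snapshot space \<open>V\<close>, so elements of
  \<open>X\<^sub>r\<close> are linear combinations of values of \<open>u\<close> and may be used as test functions in the heat
  equation. Subtracting it from the reduced order model gives
  \<open>(\<phi>\<^sub>r\<^sub>,\<^sub>t, v) + \<nu> (\<nabla>\<phi>\<^sub>r, \<nabla>v) = \<nu> (\<nabla>\<eta>, \<nabla>v)\<close> for \<open>v \<in> X\<^sub>r\<close>; the term \<open>(\<eta>\<^sub>t, v)\<close> is absent because \<open>\<eta>\<close> is
  \<open>L\<^sup>2\<close>-orthogonal to \<open>X\<^sub>r\<close>. Now take \<open>v = \<phi>\<^sub>r\<close> and use \<open>2ab \<le> a\<^sup>2 + b\<^sup>2\<close>. Bilinearity of the Dirichlet form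
  on \<open>H1 \<Omega>\<close> rests on the uniqueness of weak derivatives, that is on the fundamental lemma of the
  calculus of variations, for which smooth functions converging to indicators of boxes are built
  from \<open>exp (-1/t)\<close>.\<close>

section \<open>Orthonormal sets and minimisers of the projection error\<close>

text \<open>Sets are used instead of indexed families, so that extending becomes
  \<open>insert\<close> and dimension counts become bounds on \<open>card\<close>.\<close>

definition orthonormal :: "'b::real_inner set \<Rightarrow> bool" where
  "orthonormal B \<longleftrightarrow> (\<forall>x\<in>B. \<forall>y\<in>B. x \<bullet> y = (if x = y then 1 else 0))"

definition orth_proj :: "'b::real_inner set \<Rightarrow> 'b \<Rightarrow> 'b" where
  "orth_proj B x = (\<Sum>b\<in>B. (x \<bullet> b) *\<^sub>R b)"

lemma linear_orth_proj: "linear (orth_proj B)"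
  by (rule linearI)
    (simp_all add: orth_proj_def inner_add_left scaleR_add_left sum.distrib scaleR_sum_right)

lemma orth_proj_in_span: "orth_proj B x \<in> span B"
  unfolding orth_proj_def by (auto intro!: span_sum span_mul intro: span_base)

text \<open>The vectors orthogonal to a fixed residual form a subspace, so it suffices to test
  against \<open>B\<close> itself, where the coefficients cancel.\<close>

lemma orth_proj_residual:
  assumes "finite B" "orthonormal B" "y \<in> span B"
  shows "(x - orth_proj B x) \<bullet> y = 0"
proof -
  have "(x - orth_proj B x) \<bullet> b = 0" if "b \<in> B" for b
  proof -
    have "orth_proj B x \<bullet> b = (\<Sum>a\<in>B. (x \<bullet> a) * (if a = b then 1 else 0))"
      unfolding orth_proj_def inner_sum_left inner_scaleR_left
      using assms(2) that unfolding orthonormal_def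
      by (intro sum.cong refl arg_cong2[where f = "(*)"]) blast
    then show ?thesis
      using assms(1) that by (simp add: inner_diff_left if_distrib cong: if_cong)
  qed
  then have "span B \<subseteq> {y. (x - orth_proj B x) \<bullet> y = 0}"
    by (intro span_minimal subspace_hyperplane) blast
  then show ?thesis using assms(3) by blast
qed

lemma orth_proj_fix:
  assumes "finite B" "orthonormal B" "y \<in> span B"
  shows "orth_proj B y = y"
proof -
  have "y - orth_proj B y \<in> span B"
    using assms(3) orth_proj_in_span by (rule span_diff)
  from orth_proj_residual[OF assms(1,2) this, of y] have "y - orth_proj B y = 0"
    unfolding inner_eq_zero_iff .
  then show ?thesis by simp
qed

text \<open>The difference \<open>orth_proj B x - y\<close> stays in \<open>span B\<close>, to which
  the residual is orthogonal.\<close>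

lemma orth_proj_pythagoras:
  assumes "finite B" "orthonormal B" "y \<in> span B"
  shows "(norm (x - y))\<^sup>2 = (norm (x - orth_proj B x))\<^sup>2 + (norm (orth_proj B x - y))\<^sup>2"
proof -
  have "orth_proj B x - y \<in> span B"
    using orth_proj_in_span assms(3) by (rule span_diff)
  from orth_proj_residual[OF assms(1,2) this, of x] show ?thesis
    using norm_add_Pythagorean[of "x - orth_proj B x" "orth_proj B x - y"]
    by (simp add: orthogonal_def)
qed

lemma orth_proj_norm_le:
  assumes "finite B" "orthonormal B" "y \<in> span B"
  shows "(norm (x - orth_proj B x))\<^sup>2 \<le> (norm (x - y))\<^sup>2"
  using orth_proj_pythagoras[OF assms, of x] zero_le_power2[of "norm (orth_proj B x - y)"]
  by linarith

section \<open>Independence, Gram-Schmidt and extension of orthonormal sets\<close>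

lemma orthonormal_independent:
  assumes "orthonormal B"
  shows "independent B"
proof (rule pairwise_orthogonal_independent)
  show "pairwise orthogonal B"
    using assms by (auto simp: pairwise_def orthogonal_def orthonormal_def)
  show "0 \<notin> B"
    using assms by (force simp: orthonormal_def)
qed

text \<open>One Gram-Schmidt step: \<open>e\<close> is the normalised residual of \<open>v\<close>.
  The two span memberships let \<open>v\<close> and \<open>e\<close> be exchanged; orthogonality of
  \<open>e\<close> to all of \<open>span B\<close> later measures the gain from adding
  \<open>e\<close>.\<close>

lemma gram_schmidt_extend:
  assumes B: "finite B" "orthonormal B" and v: "v \<notin> span B"
  obtains e where "e \<notin> B" "orthonormal (insert e B)" "e \<in> span (insert v B)"
    "v \<in> span (insert e B)" "\<And>y. y \<in> span B \<Longrightarrow> y \<bullet> e = 0"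
proof
  define w where "w = v - orth_proj B v"
  define e where "e = w /\<^sub>R norm w"
  have w0: "w \<noteq> 0"
    using v orth_proj_in_span[of B v] by (auto simp: w_def)
  show orth: "y \<bullet> e = 0" if "y \<in> span B" for y
    using orth_proj_residual[OF B that, of v] by (simp add: e_def w_def inner_commute)
  have "e \<bullet> e = 1"
    using w0 by (simp add: e_def power2_norm_eq_inner[symmetric] power2_eq_square)
  moreover have "y \<bullet> e = 0" "e \<bullet> y = 0" if "y \<in> B" for y
    using orth[OF span_base[OF that]] by (simp_all add: inner_commute)
  ultimately show "e \<notin> B" "orthonormal (insert e B)"
    using B(2) by (auto simp: orthonormal_def)
  have PB: "orth_proj B v \<in> span (insert x B)" for x
    using orth_proj_in_span span_mono[of B "insert x B"] by blast
  show "e \<in> span (insert v B)"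
    unfolding e_def w_def by (intro span_mul span_diff PB) (simp add: span_base)
  have "v = norm w *\<^sub>R e + orth_proj B v"
    using w0 by (simp add: e_def w_def)
  also have "\<dots> \<in> span (insert e B)"
    by (intro span_add span_mul PB) (simp add: span_base)
  finally show "v \<in> span (insert e B)" .
qed

text \<open>Induction over \<open>A\<close>: a vector already in the span is dropped, any other
  contributes one Gram-Schmidt vector, so the cardinality never exceeds that of
  \<open>A\<close>.\<close>

lemma orthonormal_basis_of_span:
  assumes "finite (A :: 'b::real_inner set)"
  obtains B where "finite B" "card B \<le> card A" "orthonormal B" "span B = span A"
proof -
  have "\<exists>B. finite B \<and> card B \<le> card A \<and> orthonormal B \<and> span B = span A"
    using assms
  proof induction
    case empty
    show ?case by (intro exI[of _ "{}"]) (simp add: orthonormal_def)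
  next
    case (insert a A)
    then obtain B where B: "finite B" "card B \<le> card A" "orthonormal B" "span B = span A"
      by blast
    have aA: "span (insert a A) = span (insert a B)"
      using B(4) by (simp add: span_insert)
    show ?case
    proof (cases "a \<in> span B")
      case True
      then show ?thesis
        using B aA insert.hyps by (intro exI[of _ B]) (simp add: span_redundant)
    next
      case False
      then obtain e where e: "e \<notin> B" "orthonormal (insert e B)" "e \<in> span (insert a B)"
          "a \<in> span (insert e B)"
        using gram_schmidt_extend[OF B(1,3)] by metis
      have "span (insert e B) = span (insert a B)"
        using e(3,4) by (auto simp: span_eq intro: span_base)
      then show ?thesis
        using B e aA insert.hyps by (intro exI[of _ "insert e B"]) simp
    qed
  qed
  then show ?thesis using that by blast
qed

lemma orthonormal_not_spanning:
  assumes "finite B" "card B < dim V"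
  obtains v where "v \<in> V" "v \<notin> span (B :: 'b::real_inner set)"
proof -
  have "\<not> V \<subseteq> span B"
    using dim_le_card[of V B] assms by auto
  then show ?thesis using that by blast
qed

text \<open>The size grows one by one: below \<open>dim V\<close> some vector of \<open>V\<close>
  escapes the current span, and its Gram-Schmidt vector remains in \<open>V\<close>.\<close>

lemma orthonormal_extend:
  assumes "finite B" "orthonormal B" "B \<subseteq> V" "card B \<le> r" "r \<le> dim V"
    and V: "subspace (V :: 'b::real_inner set)"
  obtains C where "finite C" "orthonormal C" "B \<subseteq> C" "C \<subseteq> V" "card C = r"
proof -
  have "\<exists>C. finite C \<and> orthonormal C \<and> B \<subseteq> C \<and> C \<subseteq> V \<and> card C = r"
    using assms(4,5)
  proof (induction r rule: dec_induct)
    case base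
    then show ?case using assms by blast
  next
    case (step n)
    then obtain C where C: "finite C" "orthonormal C" "B \<subseteq> C" "C \<subseteq> V" "card C = n"
      by auto
    obtain v where v: "v \<in> V" "v \<notin> span C"
      using orthonormal_not_spanning[of C V] C step.prems by auto
    obtain e where e: "e \<notin> C" "orthonormal (insert e C)" "e \<in> span (insert v C)"
      using gram_schmidt_extend[OF C(1,2) v(2)] by metis
    have "span (insert v C) \<subseteq> V"
      using V C(4) v(1) by (intro span_minimal) auto
    then show ?case
      using C e by (intro exI[of _ "insert e C"]) auto
  qed
  then show ?thesis using that by blast
qed

text \<open>The minimiser \<open>B\<close> is first compared with the span of the projection of \<open>B\<close> to the snapshot space
  \<open>V\<close>, which shows \<open>orth_proj B s\<^sub>i \<in> V\<close>. If some element of \<open>B\<close> were outside \<open>V\<close>, these projections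
  would span a space of dimension less than \<open>card B\<close>, and adding a direction of \<open>V\<close> to it would
  decrease the error.\<close>

lemma projection_error_minimiser_in_span:
  fixes s :: "'i \<Rightarrow> 'b::real_inner"
  assumes I: "finite I" and B: "finite B" "orthonormal B" "card B \<le> dim (span (s ` I))"
    and min: "\<And>C. finite C \<Longrightarrow> orthonormal C \<Longrightarrow> C \<subseteq> span (s ` I) \<Longrightarrow> card C = card B \<Longrightarrow>
      (\<Sum>i\<in>I. (norm (s i - orth_proj B (s i)))\<^sup>2) \<le> (\<Sum>i\<in>I. (norm (s i - orth_proj C (s i)))\<^sup>2)"
  shows "B \<subseteq> span (s ` I)"
proof -
  define V where "V = span (s ` I)"
  have sub: "subspace V" by (simp add: V_def)
  have sV: "s i \<in> V" if "i \<in> I" for i using that by (simp add: V_def span_base)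
  obtain Q where Q: "finite Q" "orthonormal Q" "span Q = V"
    unfolding V_def using orthonormal_basis_of_span[of "s ` I"] I by auto
  have QV: "orth_proj Q x \<in> V" for x
    using orth_proj_in_span[of Q x] Q(3) by simp
  have PV: "orth_proj B (s i) \<in> V" if "i \<in> I" for i
  proof -
    let ?w = "\<lambda>i. orth_proj B (s i)"
    \<comment> \<open>Minimality only compares sets of size exactly \<open>card B\<close>. The
      projected set may have smaller dimension, so its basis \<open>R\<close> is filled up inside
      \<open>V\<close> to a competitor \<open>C\<close>.\<close>
    obtain R where R: "finite R" "card R \<le> card (orth_proj Q ` B)" "orthonormal R"
        "span R = span (orth_proj Q ` B)"
      using orthonormal_basis_of_span[of "orth_proj Q ` B"] B(1) by auto
    have "R \<subseteq> V"
      using span_superset[of R] R(4) span_minimal[of "orth_proj Q ` B" V] QV sub by auto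
    moreover have "card R \<le> card B"
      using R(2) card_image_le[OF B(1)] le_trans by blast
    ultimately obtain C where C: "finite C" "orthonormal C" "R \<subseteq> C" "C \<subseteq> V" "card C = card B"
      using orthonormal_extend[of R V "card B"] R B(3) sub by (auto simp: V_def)
    have "(norm (s i - orth_proj C (s i)))\<^sup>2 \<le>
        (norm (s i - ?w i))\<^sup>2 - (norm (?w i - orth_proj Q (?w i)))\<^sup>2" if "i \<in> I" for i
    proof -
      have "orth_proj Q (?w i) \<in> orth_proj Q ` span B"
        using orth_proj_in_span by blast
      also have "\<dots> = span R"
        using linear_span_image[OF linear_orth_proj] R(4) by metis
      also have "\<dots> \<subseteq> span C"
        using C(3) by (rule span_mono)
      finally have "(norm (s i - orth_proj C (s i)))\<^sup>2 \<le> (norm (s i - orth_proj Q (?w i)))\<^sup>2"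
        by (rule orth_proj_norm_le[OF C(1,2)])
      \<comment> \<open>Pythagoras for the projection onto \<open>V\<close>, applied to
        \<open>?w i\<close> and the point \<open>s i\<close> of \<open>V\<close>.\<close>
      moreover have "(norm (s i - ?w i))\<^sup>2 =
          (norm (?w i - orth_proj Q (?w i)))\<^sup>2 + (norm (s i - orth_proj Q (?w i)))\<^sup>2"
        using orth_proj_pythagoras[OF Q(1,2), of "s i" "?w i"] sV[OF that] Q(3)
        by (simp add: norm_minus_commute)
      ultimately show ?thesis by simp
    qed
    then have "(\<Sum>i\<in>I. (norm (s i - orth_proj C (s i)))\<^sup>2) \<le>
        (\<Sum>i\<in>I. (norm (s i - ?w i))\<^sup>2 - (norm (?w i - orth_proj Q (?w i)))\<^sup>2)"
      by (rule sum_mono)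
    \<comment> \<open>By minimality \<open>C\<close> cannot be better than \<open>B\<close>, so the
      total distance of the \<open>?w i\<close> from \<open>V\<close> has to vanish.\<close>
    then have "(\<Sum>i\<in>I. (norm (?w i - orth_proj Q (?w i)))\<^sup>2) \<le> 0"
      using min[of C] C by (simp add: V_def sum_subtractf)
    then have "(\<Sum>i\<in>I. (norm (?w i - orth_proj Q (?w i)))\<^sup>2) = 0"
      by (simp add: order_antisym sum_nonneg)
    then have "?w i = orth_proj Q (?w i)"
      using that I by (simp add: sum_nonneg_eq_0_iff)
    then show ?thesis using QV by metis
  qed
  show ?thesis
  proof (rule ccontr)
    assume "\<not> B \<subseteq> span (s ` I)"
    then obtain b where b: "b \<in> B" "b \<notin> V" by (auto simp: V_def)
    let ?A = "(\<lambda>i. orth_proj B (s i)) ` I"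
    obtain R where R: "finite R" "orthonormal R" "span R = span ?A"
      using orthonormal_basis_of_span[OF finite_imageI[OF I]] by metis
    have RV: "span R \<subseteq> V" and RB: "span R \<subseteq> span B"
      unfolding R(3) by (rule span_minimal; use PV orth_proj_in_span sub subspace_span in blast)+
    \<comment> \<open>Orthonormalising \<open>b\<close> against \<open>R\<close> gives one more
      vector, still inside \<open>span B\<close>; an independent set there has at most
      \<open>card B\<close> elements.\<close>
    have "card R < card B"
    proof -
      have "b \<notin> span R"
        using b(2) RV by blast
      then obtain e where e: "e \<notin> R" "orthonormal (insert e R)" "e \<in> span (insert b R)"
        using gram_schmidt_extend[OF R(1,2)] by metis
      have R': "R \<subseteq> span B"
        using RB span_superset[of R] by blast
      then have "span (insert b R) \<subseteq> span B"
        using b(1) by (intro span_minimal) (auto intro: span_base)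
      then have "insert e R \<subseteq> span B"
        using R' e(3) by auto
      from independent_span_bound[OF B(1) orthonormal_independent[OF e(2)] this]
      show ?thesis using e(1) R(1) by simp
    qed
    then obtain v where v: "v \<in> V" "v \<notin> span R"
      using orthonormal_not_spanning[of R V] R B(3) by (auto simp: V_def)
    obtain e where e: "e \<notin> R" "orthonormal (insert e R)" "e \<in> span (insert v R)"
        "\<And>y. y \<in> span R \<Longrightarrow> y \<bullet> e = 0"
      using gram_schmidt_extend[OF R(1,2) v(2)] by metis
    have R': "R \<subseteq> V"
      using RV span_superset[of R] by blast
    have "span (insert v R) \<subseteq> V"
      using v(1) sub R' by (intro span_minimal) auto
    then have eV: "e \<in> V" using e(3) by blast
    obtain C where C: "finite C" "orthonormal C" "insert e R \<subseteq> C" "C \<subseteq> V" "card C = card B"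
      using orthonormal_extend[of "insert e R" V "card B"] R e(1,2) eV R' \<open>card R < card B\<close> B(3) sub
      by (auto simp: V_def)
    \<comment> \<open>The vector \<open>?w + (s i \<bullet> e) *\<^sub>R e\<close> lies in
      \<open>span C\<close>. As \<open>e\<close> is a unit vector orthogonal to \<open>?w\<close>,
      the added term lowers the squared error by exactly
      \<open>(s i \<bullet> e)\<^sup>2\<close>.\<close>
    have "(norm (s i - orth_proj C (s i)))\<^sup>2 \<le> (norm (s i - orth_proj B (s i)))\<^sup>2 - (s i \<bullet> e)\<^sup>2"
      if "i \<in> I" for i
    proof -
      let ?w = "orth_proj B (s i)"
      have w: "?w \<in> span R"
        using that R(3) by (auto intro: span_base)
      have "span R \<subseteq> span C" "e \<in> span C"
        using span_mono[of R C] span_base[of e C] C(3) by auto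
      then have "?w + (s i \<bullet> e) *\<^sub>R e \<in> span C"
        using w by (intro span_add span_mul) auto
      from orth_proj_norm_le[OF C(1,2) this]
      have "(norm (s i - orth_proj C (s i)))\<^sup>2 \<le> (norm ((s i - ?w) - (s i \<bullet> e) *\<^sub>R e))\<^sup>2"
        by (simp add: diff_diff_eq)
      also have "\<dots> = (norm (s i - ?w))\<^sup>2 - (s i \<bullet> e)\<^sup>2"
      proof -
        have "e \<bullet> e = 1"
          using e(2) by (simp add: orthonormal_def)
        moreover have "(s i - ?w) \<bullet> e = s i \<bullet> e"
          using e(4)[OF w] by (simp add: inner_diff_left)
        moreover have "(norm (x - c *\<^sub>R e))\<^sup>2 = (norm x)\<^sup>2 - 2 * c * (x \<bullet> e) + c * c * (e \<bullet> e)" for x c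
          by (simp add: power2_norm_eq_inner inner_diff_left inner_diff_right inner_commute[of e x] right_diff_distrib)
        ultimately show ?thesis
          by (simp add: power2_eq_square)
      qed
      finally show ?thesis .
    qed
    then have "(\<Sum>i\<in>I. (norm (s i - orth_proj C (s i)))\<^sup>2) \<le>
        (\<Sum>i\<in>I. (norm (s i - orth_proj B (s i)))\<^sup>2 - (s i \<bullet> e)\<^sup>2)"
      by (rule sum_mono)
    then have "(\<Sum>i\<in>I. (s i \<bullet> e)\<^sup>2) \<le> 0"
      using min[of C] C by (simp add: V_def sum_subtractf)
    then have "(\<Sum>i\<in>I. (s i \<bullet> e)\<^sup>2) = 0"
      by (simp add: order_antisym sum_nonneg)
    then have "\<forall>i\<in>I. s i \<bullet> e = 0"
      using I by (simp add: sum_nonneg_eq_0_iff)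
    \<comment> \<open>No gain means that \<open>e\<close> is orthogonal to every snapshot, hence to
      \<open>V\<close>, although it is a unit vector of \<open>V\<close>.\<close>
    then have "V \<subseteq> {x. e \<bullet> x = 0}"
      unfolding V_def by (intro span_minimal subspace_hyperplane) (auto simp: inner_commute)
    then have "e \<bullet> e = 0" using eV by blast
    then show False using e(2) by (simp add: orthonormal_def)
  qed
qed

section \<open>Coordinates and the projection onto a span\<close>

lemma norm_sq_eq_sum_inner:
  assumes "finite B" "orthonormal B" "x \<in> span B"
  shows "(norm x)\<^sup>2 = (\<Sum>b\<in>B. (x \<bullet> b)\<^sup>2)"
proof -
  have "(norm x)\<^sup>2 = x \<bullet> orth_proj B x"
    using orth_proj_fix[OF assms] by (simp add: power2_norm_eq_inner)
  also have "\<dots> = (\<Sum>b\<in>B. (x \<bullet> b)\<^sup>2)"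
    by (simp add: orth_proj_def inner_sum_right power2_eq_square)
  finally show ?thesis .
qed

text \<open>This justifies the definite description: the difference of two candidates lies in
  \<open>span B\<close> and is orthogonal to \<open>span B\<close>, hence to itself.\<close>

lemma L2_projection_eq_orth_proj:
  assumes "finite B" "orthonormal B"
  shows "L2_projection (span B) x = orth_proj B x"
  unfolding L2_projection_def
proof (rule the_equality)
  show "orth_proj B x \<in> span B \<and> (\<forall>v\<in>span B. (x - orth_proj B x) \<bullet> v = 0)"
    using orth_proj_in_span orth_proj_residual[OF assms] by blast
next
  fix p assume p: "p \<in> span B \<and> (\<forall>v\<in>span B. (x - p) \<bullet> v = 0)"
  then have d: "p - orth_proj B x \<in> span B"
    using orth_proj_in_span span_diff by blast
  have "(p - orth_proj B x) \<bullet> (p - orth_proj B x) =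
      (x - orth_proj B x) \<bullet> (p - orth_proj B x) - (x - p) \<bullet> (p - orth_proj B x)"
    by (simp add: inner_diff_left)
  also have "\<dots> = 0"
    using orth_proj_residual[OF assms d] p d by simp
  finally show "p = orth_proj B x" by simp
qed

section \<open>Smooth bump functions on boxes\<close>

text \<open>Up to linear combinations this family is closed under differentiation.\<close>

definition exp_germ :: "nat \<Rightarrow> real \<Rightarrow> real" where
  "exp_germ n t = (if t > 0 then inverse t ^ n * exp (- inverse t) else 0)"

text \<open>From the right, substitute the reciprocal of \<open>t\<close>: a power divided by the
  exponential vanishes at infinity. On the left the function is zero.\<close>

lemma exp_germ_tendsto_0: "(exp_germ n \<longlongrightarrow> 0) (at 0)"
proof -
  have "((\<lambda>t. inverse t ^ n / exp (inverse t)) \<longlongrightarrow> (0::real)) (at_right 0)"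
    by (rule filterlim_compose[OF tendsto_power_div_exp_0 filterlim_inverse_at_top_right])
  then have "(exp_germ n \<longlongrightarrow> 0) (at_right 0)"
    by (rule Lim_transform_eventually)
      (auto simp: eventually_at_right_field exp_germ_def exp_minus field_simps intro!: exI[of _ 1])
  moreover have "(exp_germ n \<longlongrightarrow> 0) (at_left 0)"
    by (rule tendsto_eventually) (auto simp: eventually_at_left_field exp_germ_def intro!: exI[of _ "-1"])
  ultimately show ?thesis by (simp add: filterlim_split_at)
qed

lemma exp_germ_has_derivative:
  "(exp_germ n has_real_derivative exp_germ (n + 2) t - real n * exp_germ (n + 1) t) (at t)"
proof -
  consider "t > 0" | "t < 0" | "t = 0" by linarith
  then show ?thesis
  proof cases
    case 1
    have "((\<lambda>t. inverse t ^ n * exp (- inverse t)) has_real_derivative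
        exp_germ (n + 2) t - real n * exp_germ (n + 1) t) (at t)"
    proof -
      \<comment> \<open>Covers the truncated exponent \<open>n - 1\<close> at \<open>n = 0\<close>,
        where the factor \<open>real n\<close> vanishes.\<close>
      have n: "real n * inverse t ^ (n - 1) * inverse t = real n * inverse t ^ n"
        by (cases n) auto
      have "((\<lambda>t. inverse t ^ n * exp (- inverse t)) has_real_derivative
          (real n * inverse t ^ (n - 1) * (- (inverse t * inverse t))) * exp (- inverse t) +
          inverse t ^ n * (exp (- inverse t) * (inverse t * inverse t))) (at t)"
        using 1 by (auto intro!: derivative_eq_intros)
      also have "(real n * inverse t ^ (n - 1) * (- (inverse t * inverse t))) * exp (- inverse t) +
          inverse t ^ n * (exp (- inverse t) * (inverse t * inverse t)) =
          inverse t ^ (n + 2) * exp (- inverse t) -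
          (real n * inverse t ^ (n - 1) * inverse t) * inverse t * exp (- inverse t)"
        by (simp add: algebra_simps)
      finally show ?thesis
        using 1 by (simp only: n) (simp add: exp_germ_def algebra_simps)
    qed
    then show ?thesis
      by (rule has_field_derivative_transform_within_open[of _ _ _ "{0<..}"])
        (use 1 in \<open>auto simp: exp_germ_def\<close>)
  next
    case 2
    have "((\<lambda>t. 0) has_real_derivative exp_germ (n + 2) t - real n * exp_germ (n + 1) t) (at t)"
      using 2 by (auto simp: exp_germ_def)
    then show ?thesis
      by (rule has_field_derivative_transform_within_open[of _ _ _ "{..<0}"])
        (use 2 in \<open>auto simp: exp_germ_def\<close>)
  next
    case 3
    \<comment> \<open>At the origin the difference quotient is itself a member of the family, so its
      limit is already known.\<close>
    have "(exp_germ n t - exp_germ n 0) / (t - 0) = exp_germ (n + 1) t" for t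
      by (simp add: exp_germ_def field_simps)
    then show ?thesis
      using 3 exp_germ_tendsto_0[of "n + 1"]
      by (simp add: has_field_derivative_iff exp_germ_def[of _ 0])
  qed
qed

lemma exp_germ_0_bounds: "0 \<le> exp_germ 0 t" "exp_germ 0 t \<le> 1"
  by (auto simp: exp_germ_def)

lemma exp_germ_0_eq_0_iff: "exp_germ 0 t = 0 \<longleftrightarrow> t \<le> 0"
  by (auto simp: exp_germ_def)

lemma exp_germ_0_scaled_tendsto_1:
  assumes "t > 0"
  shows "(\<lambda>n. exp_germ 0 (real n * t)) \<longlonglongrightarrow> 1"
proof (rule Lim_transform_eventually)
  have "(\<lambda>n. exp (- (inverse (real n) * inverse t))) \<longlonglongrightarrow> exp (- (0 * inverse t))"
    by (intro tendsto_intros lim_inverse_n)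
  then show "(\<lambda>n. exp (- (inverse (real n) * inverse t))) \<longlonglongrightarrow> 1"
    by simp
  show "\<forall>\<^sub>F n in sequentially. exp (- (inverse (real n) * inverse t)) = exp_germ 0 (real n * t)"
    using assms by (auto simp: eventually_sequentially exp_germ_def field_simps intro!: exI[of _ 1])
qed

section \<open>Functions differentiable a given number of times\<close>

lemma times_differentiable_imp_continuous:
  fixes f :: "'a::euclidean_space \<Rightarrow> real"
  shows "times_differentiable n f \<Longrightarrow> continuous_on UNIV f"
  by (cases n) (auto intro: differentiable_imp_continuous_on simp: differentiable_on_def)

lemma times_differentiable_SucD:
  fixes f :: "'a::euclidean_space \<Rightarrow> real"
  shows "times_differentiable (Suc n) f \<Longrightarrow> times_differentiable n f"
proof (induction n arbitrary: f)
  case 0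
  then show ?case using times_differentiable_imp_continuous by fastforce
next
  case (Suc n)
  then show ?case by simp
qed

text \<open>By uniqueness of the derivative, the inductions below may use an explicit formula in
  place of \<open>frechet_derivative\<close>.\<close>

lemma times_differentiable_Suc_iff:
  fixes f :: "'a::euclidean_space \<Rightarrow> real"
  assumes "\<And>x. (f has_derivative f' x) (at x)"
  shows "times_differentiable (Suc n) f \<longleftrightarrow> (\<forall>h. times_differentiable n (\<lambda>x. f' x h))"
  using assms frechet_derivative_at[OF assms] by (auto simp: differentiable_def)

lemma times_differentiable_const:
  "times_differentiable n (\<lambda>x::'a::euclidean_space. c)"
  by (induction n arbitrary: c) (auto simp: frechet_derivative_const)

lemma times_differentiable_add:
  fixes f g :: "'a::euclidean_space \<Rightarrow> real"
  shows "times_differentiable n f \<Longrightarrow> times_differentiable n g \<Longrightarrow>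
    times_differentiable n (\<lambda>x. f x + g x)"
proof (induction n arbitrary: f g)
  case 0
  then show ?case by (simp add: continuous_on_add continuous_on_mult)
next
  case (Suc n)
  then have "((\<lambda>x. f x + g x) has_derivative
      (\<lambda>h. frechet_derivative f (at x) h + frechet_derivative g (at x) h)) (at x)" for x
    by (intro has_derivative_add) (auto simp: frechet_derivative_works[symmetric])
  from times_differentiable_Suc_iff[OF this] Suc show ?case by auto
qed

lemma times_differentiable_mult:
  fixes f g :: "'a::euclidean_space \<Rightarrow> real"
  shows "times_differentiable n f \<Longrightarrow> times_differentiable n g \<Longrightarrow>
    times_differentiable n (\<lambda>x. f x * g x)"
proof (induction n arbitrary: f g)
  case 0
  then show ?case by (simp add: continuous_on_add continuous_on_mult)
next
  case (Suc n)
  then have "((\<lambda>x. f x * g x) has_derivative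
      (\<lambda>h. f x * frechet_derivative g (at x) h + frechet_derivative f (at x) h * g x)) (at x)" for x
    by (intro has_derivative_mult) (auto simp: frechet_derivative_works[symmetric])
  \<comment> \<open>The product rule keeps one factor undifferentiated, so its order is first
    lowered from \<open>Suc n\<close> to \<open>n\<close>.\<close>
  from times_differentiable_Suc_iff[OF this] Suc show ?case
    using times_differentiable_SucD[OF Suc.prems(1)] times_differentiable_SucD[OF Suc.prems(2)]
    by (auto intro!: times_differentiable_add)
qed

lemma times_differentiable_prod:
  fixes f :: "'i \<Rightarrow> 'a::euclidean_space \<Rightarrow> real"
  shows "(\<And>i. i \<in> I \<Longrightarrow> times_differentiable n (f i)) \<Longrightarrow>
    times_differentiable n (\<lambda>x. \<Prod>i\<in>I. f i x)"
  by (induction I rule: infinite_finite_induct)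
    (auto intro: times_differentiable_mult times_differentiable_const)

text \<open>The index \<open>m\<close> varies in the induction, since differentiation replaces it by
  \<open>m + 1\<close> and \<open>m + 2\<close>.\<close>

lemma times_differentiable_exp_germ:
  fixes v :: "'a::euclidean_space"
  shows "times_differentiable n (\<lambda>x. exp_germ m (v \<bullet> x + c))"
proof (induction n arbitrary: m)
  case 0
  have "continuous_on UNIV (exp_germ m)"
    using exp_germ_has_derivative DERIV_isCont by (blast intro: continuous_at_imp_continuous_on)
  then have "continuous_on UNIV (\<lambda>x. exp_germ m (v \<bullet> x + c))"
    by (rule continuous_on_compose2)
      (auto intro!: continuous_on_add continuous_on_inner continuous_on_const continuous_on_id)
  then show ?case by simp
next
  case (Suc n)
  let ?D = "\<lambda>x. exp_germ (m + 2) (v \<bullet> x + c) - real m * exp_germ (m + 1) (v \<bullet> x + c)"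
  have "((\<lambda>x. exp_germ m (v \<bullet> x + c)) has_derivative (\<lambda>h. ?D x * (v \<bullet> h))) (at x)" for x
    by (rule has_derivative_compose[of "\<lambda>x. v \<bullet> x + c" _ _ _ "exp_germ m",
          OF _ exp_germ_has_derivative[unfolded has_field_derivative_def]])
      (auto intro!: derivative_eq_intros)
  moreover have "times_differentiable n (\<lambda>x. ?D x * (v \<bullet> h))" for h
    using times_differentiable_mult[OF times_differentiable_add[OF Suc[of "m + 2"]
      times_differentiable_mult[OF times_differentiable_const[of n "- real m"] Suc[of "m + 1"]]]
      times_differentiable_const[of n "v \<bullet> h"]] by simp
  ultimately show ?case
    by (subst times_differentiable_Suc_iff) auto
qed

section \<open>Bumps approximating the indicator of a box\<close>

definition box_bump :: "'a::euclidean_space \<Rightarrow> 'a \<Rightarrow> nat \<Rightarrow> 'a \<Rightarrow> real" where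
  "box_bump a b n x = (\<Prod>i\<in>Basis.
     exp_germ 0 (real n * ((x - a) \<bullet> i)) * exp_germ 0 (real n * ((b - x) \<bullet> i)))"

lemma box_bump_bounds: "0 \<le> box_bump a b n x" "box_bump a b n x \<le> 1"
  unfolding box_bump_def
  by (intro prod_nonneg mult_nonneg_nonneg exp_germ_0_bounds ballI)
    (intro prod_le_1 conjI mult_nonneg_nonneg mult_le_one exp_germ_0_bounds)

lemma box_bump_eq_0: "x \<notin> box a b \<Longrightarrow> box_bump a b n x = 0"
  by (fastforce simp: box_bump_def mem_box exp_germ_0_eq_0_iff not_less inner_diff_left
    intro: mult_nonneg_nonpos)

text \<open>The parameter \<open>n\<close> only steepens the flanks and leaves the box fixed: at an
  interior point all arguments are positive and every factor tends to 1.\<close>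

lemma box_bump_tendsto: "(\<lambda>n. box_bump a b n x) \<longlonglongrightarrow> indicator (box a b) x"
proof (cases "x \<in> box a b")
  case True
  then have "(\<lambda>n. box_bump a b n x) \<longlonglongrightarrow> (\<Prod>i\<in>(Basis::'a set). 1 * 1)"
    unfolding box_bump_def
    by (intro tendsto_prod tendsto_mult exp_germ_0_scaled_tendsto_1)
      (auto simp: mem_box inner_diff_left)
  then show ?thesis using True by simp
qed (simp add: box_bump_eq_0)

lemma box_bump_in_test_functions:
  assumes "cbox a b \<subseteq> \<Omega>"
  shows "box_bump a b n \<in> test_functions \<Omega>"
proof -
  have "times_differentiable k (box_bump a b n)" for k
  proof -
    have eq: "real n * ((x - a) \<bullet> i) = (real n *\<^sub>R i) \<bullet> x + - real n * (a \<bullet> i)"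
      "real n * ((b - x) \<bullet> i) = (- real n *\<^sub>R i) \<bullet> x + real n * (b \<bullet> i)" for x i
      by (simp_all add: inner_diff_left inner_commute algebra_simps)
    show ?thesis
      unfolding box_bump_def eq
      by (intro times_differentiable_prod times_differentiable_mult times_differentiable_exp_germ)
  qed
  moreover have "closure {x. box_bump a b n x \<noteq> 0} \<subseteq> cbox a b"
    using box_bump_eq_0[of _ a b n] box_subset_cbox[of a b]
    by (intro closure_minimal) (auto simp: closed_cbox)
  moreover from this have "compact (closure {x. box_bump a b n x \<noteq> 0})"
    by (meson bounded_cbox bounded_subset closed_closure compact_eq_bounded_closed)
  ultimately show ?thesis
    using assms by (auto simp: test_functions_def)
qed

section \<open>Uniqueness of weak derivatives\<close>

lemma square_integrable_continuous_compact_support: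
  assumes f: "continuous_on UNIV f" and K: "compact K" and 0: "\<And>x. x \<notin> K \<Longrightarrow> f x = 0"
  shows "square_integrable f"
proof -
  have "integrable lborel (\<lambda>x. indicator K x *\<^sub>R (f x)\<^sup>2)"
    using K f by (intro borel_integrable_compact continuous_on_power) (auto intro: continuous_on_subset)
  also have "(\<lambda>x. indicator K x *\<^sub>R (f x)\<^sup>2) = (\<lambda>x. (f x)\<^sup>2)"
    using 0 by (auto simp: indicator_def fun_eq_iff)
  finally show ?thesis
    using f by (simp add: square_integrable_def borel_measurable_continuous_onI)
qed

lemma square_integrable_test_function:
  assumes "\<psi> \<in> test_functions \<Omega>"
  shows "square_integrable \<psi>"
proof (rule square_integrable_continuous_compact_support)
  have "times_differentiable 0 \<psi>"
    using assms unfolding test_functions_def by blast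
  then show "continuous_on UNIV \<psi>" by simp
  show "compact (closure {x. \<psi> x \<noteq> 0})"
    using assms unfolding test_functions_def by blast
  show "\<psi> x = 0" if "x \<notin> closure {x. \<psi> x \<noteq> 0}" for x
    using that closure_subset[of "{x. \<psi> x \<noteq> 0}"] by blast
qed

lemma square_integrable_indicator:
  assumes "A \<in> sets lborel" "emeasure lborel A < \<infinity>"
  shows "square_integrable (indicator A)"
proof -
  have "(\<lambda>x. (indicator A x)\<^sup>2) = (indicator A :: 'a \<Rightarrow> real)"
    by (auto simp: indicator_def)
  then show ?thesis
    using assms by (simp add: square_integrable_def)
qed

section \<open>The fundamental lemma of the calculus of variations\<close>

lemma inner_L2_abs:
  assumes "square_integrable f" "square_integrable g"
  shows "inner (abs_L2 f) (abs_L2 g) = (\<integral>x. f x * g x \<partial>lborel)"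
  using assms by (simp add: inner_L2.abs_eq l2_rel_refl_iff)

text \<open>Dominated convergence along the bumps: they are admissible test functions, bounded by
  the indicator of the box, so \<open>f\<close> restricted to the box dominates.\<close>

lemma integral_box_eq_0:
  fixes f :: "'a::euclidean_space \<Rightarrow> real"
  assumes f: "square_integrable f"
    and 0: "\<And>\<psi>. \<psi> \<in> test_functions \<Omega> \<Longrightarrow> (\<integral>x. f x * \<psi> x \<partial>lborel) = 0"
    and "cbox a b \<subseteq> \<Omega>"
  shows "(\<integral>x. f x * indicator (box a b) x \<partial>lborel) = 0"
proof -
  have bump: "box_bump a b n \<in> test_functions \<Omega>" for n
    using assms(3) by (rule box_bump_in_test_functions)
  have ind: "integrable lborel (\<lambda>x. f x * indicator (box a b) x)"
    by (intro square_integrable_mult f square_integrable_indicator) (use emeasure_lborel_box_finite in auto)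
  have "(\<lambda>n. \<integral>x. f x * box_bump a b n x \<partial>lborel) \<longlonglongrightarrow>
      (\<integral>x. f x * indicator (box a b) x \<partial>lborel)"
  proof (rule integral_dominated_convergence)
    show "integrable lborel (\<lambda>x. norm (f x * indicator (box a b) x))"
      using ind by (rule integrable_norm)
    show "AE x in lborel. (\<lambda>n. f x * box_bump a b n x) \<longlonglongrightarrow> f x * indicator (box a b) x"
      by (intro AE_I2 tendsto_mult tendsto_const box_bump_tendsto)
    have "\<bar>f x * box_bump a b n x\<bar> \<le> \<bar>f x * indicator (box a b) x\<bar>" for n x
      using box_bump_bounds[of a b n x] box_bump_eq_0[of x a b n]
      by (cases "x \<in> box a b") (auto simp: abs_mult intro: mult_left_le)
    then show "AE x in lborel. norm (f x * box_bump a b n x) \<le> norm (f x * indicator (box a b) x)" for n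
      by simp
    show "(\<lambda>x. f x * box_bump a b n x) \<in> borel_measurable lborel" for n
      using f square_integrable_test_function[OF bump]
      by (intro borel_measurable_times) (auto simp: square_integrable_def)
  qed (use ind in auto)
  moreover have "(\<integral>x. f x * box_bump a b n x \<partial>lborel) = 0" for n
    using bump by (rule 0)
  ultimately show ?thesis
    using LIMSEQ_unique[of "\<lambda>n. 0" 0] by simp
qed

text \<open>Dynkin argument: boxes are closed under intersection and generate the Borel sets, and
  the sets on which \<open>f\<close> integrates to 0 form a Dynkin system. The assumption
  \<open>total\<close> supplies the complements. Then \<open>f\<close> and 0 have equal integrals
  over every Borel set.\<close>

lemma AE_eq_0_if_box_integrals_eq_0:
  fixes f :: "'a::euclidean_space \<Rightarrow> real"
  assumes f: "integrable lborel f" and total: "integral\<^sup>L lborel f = 0"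
    and 0: "\<And>a b. (\<integral>x. indicator (box a b) x * f x \<partial>lborel) = 0"
  shows "AE x in lborel. f x = 0"
proof (rule density_unique_real[where f' = "\<lambda>x. 0"])
  let ?E = "range (\<lambda>(a, b). box a b :: 'a set)"
  have E: "Int_stable ?E" "?E \<subseteq> Pow UNIV"
    by (auto simp: Int_stable_def box_Int_box)
  have sets: "sigma_sets UNIV ?E = sets lborel"
    by (simp add: borel_eq_box)
  have int: "set_integrable lborel A f" if "A \<in> sets lborel" for A
    using integrable_mult_indicator[OF that f] by (simp add: set_integrable_def)
  fix A :: "'a set" assume "A \<in> sets lborel"
  then have "A \<in> sigma_sets UNIV ?E"
    using sets by simp
  with E have "(LINT x:A|lborel. f x) = 0"
  proof (induction rule: sigma_sets_induct_disjoint)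
    case (basic A)
    then show ?case using 0 by (auto simp: set_lebesgue_integral_def)
  next
    case empty
    show ?case by (simp add: set_lebesgue_integral_def)
  next
    case (compl A)
    then have A: "A \<in> sets lborel" using sets by blast
    have "(LINT x:UNIV - A|lborel. f x) = (\<integral>x. f x - indicator A x *\<^sub>R f x \<partial>lborel)"
      unfolding set_lebesgue_integral_def
      by (intro Bochner_Integration.integral_cong) (auto simp: indicator_def)
    also have "\<dots> = integral\<^sup>L lborel f - (LINT x:A|lborel. f x)"
      unfolding set_lebesgue_integral_def using f int[OF A]
      by (intro Bochner_Integration.integral_diff) (auto simp: set_integrable_def)
    finally show ?case using total compl by simp
  next
    case (union A)
    then have A: "A i \<in> sets lborel" for i using sets by blast
    have "(LINT x:(\<Union>i. A i)|lborel. f x) = (\<Sum>i. LINT x:A i|lborel. f x)"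
      using A union(1) by (intro lebesgue_integral_countable_add int) (auto simp: disjoint_family_on_def)
    then show ?case using union by simp
  qed
  then show "(LINT x:A|lborel. f x) = (LINT x:A|lborel. 0)"
    by (simp add: set_lebesgue_integral_def)
qed (use f in auto)

lemma cbox_diff_box_null: "cbox a b - box a b \<in> null_sets lborel"
  using negligible_frontier_interval[of a b]
  by (simp add: negligible_iff_null_sets null_sets_completion_iff)

text \<open>The set \<open>\<Omega>\<close> is a countable union of closed boxes. On each,
  \<open>f\<close> cut off to the open box has vanishing box integrals; boundaries and countable
  unions of exceptional sets are null.\<close>

lemma fundamental_lemma_of_variations:
  fixes f :: "'a::euclidean_space \<Rightarrow> real"
  assumes "open \<Omega>" and f: "square_integrable f"
    and 0: "\<And>\<psi>. \<psi> \<in> test_functions \<Omega> \<Longrightarrow> (\<integral>x. f x * \<psi> x \<partial>lborel) = 0"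
  shows "AE x in lborel. x \<in> \<Omega> \<longrightarrow> f x = 0"
proof -
  obtain \<D> where D: "countable \<D>" "\<D> \<subseteq> Pow \<Omega>" "\<And>X. X \<in> \<D> \<Longrightarrow> \<exists>a b. X = cbox a b" "\<Union>\<D> = \<Omega>"
    using open_countable_Union_open_cbox[OF \<open>open \<Omega>\<close>] by metis
  have "AE x in lborel. x \<in> X \<longrightarrow> f x = 0" if XD: "X \<in> \<D>" for X
  proof -
    obtain c d where X: "X = cbox c d" "cbox c d \<subseteq> \<Omega>"
      using D(3)[OF XD] D(2) XD by blast
    \<comment> \<open>Bumps need the closed box inside \<open>\<Omega>\<close>. Nonemptiness
      matters: only then is \<open>cbox a b\<close> the closure of \<open>box a b\<close>; a
      degenerate closed box could lie anywhere.\<close>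
    have sub: "cbox a b \<subseteq> cbox c d" if "box a b \<subseteq> box c d" "box a b \<noteq> {}" for a b
      using that(1) box_subset_cbox[of c d] closure_minimal[of "box a b" "cbox c d"] closed_cbox
      unfolding closure_box[OF that(2)] by blast
    have int0: "(\<integral>x. f x * indicator (box a b) x \<partial>lborel) = 0" if "box a b \<subseteq> box c d" for a b
    proof (cases "box a b = {}")
      case False
      then show ?thesis
        using sub[OF that] X(2) by (intro integral_box_eq_0[where \<Omega> = \<Omega>, OF f 0]) auto
    qed simp
    have "AE x in lborel. f x * indicator (box c d) x = 0"
    proof (rule AE_eq_0_if_box_integrals_eq_0)
      show "integrable lborel (\<lambda>x. f x * indicator (box c d) x)"
        by (intro square_integrable_mult f square_integrable_indicator) (use emeasure_lborel_box_finite in auto)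
      show "(\<integral>x. f x * indicator (box c d) x \<partial>lborel) = 0"
        by (rule int0) simp
      fix a b
      obtain a' b' where ab: "box a b \<inter> box c d = box a' b'"
        using box_Int_box by blast
      have "(\<integral>x. indicator (box a b) x * (f x * indicator (box c d) x) \<partial>lborel) =
          (\<integral>x. f x * indicator (box a b \<inter> box c d) x \<partial>lborel)"
        by (intro Bochner_Integration.integral_cong) (auto simp: indicator_def)
      also have "\<dots> = 0"
        unfolding ab using ab by (intro int0) blast
      finally show "(\<integral>x. indicator (box a b) x * (f x * indicator (box c d) x) \<partial>lborel) = 0" .
    qed
    with AE_not_in[OF cbox_diff_box_null[of c d]] show ?thesis
      by eventually_elim (auto simp: X indicator_def split: if_splits)
  qed
  then have "AE x in lborel. \<forall>X\<in>\<D>. x \<in> X \<longrightarrow> f x = 0"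
    unfolding AE_ball_countable[OF D(1)] by blast
  then show ?thesis
    by eventually_elim (use D(4) in blast)
qed

text \<open>Inside \<open>\<Omega>\<close> the fundamental lemma applies; outside, membership in
  \<open>L2_on \<Omega>\<close> forces zero.\<close>

lemma L2_on_eq_0I:
  assumes "open \<Omega>" "g \<in> L2_on \<Omega>"
    and "\<And>\<psi>. \<psi> \<in> test_functions \<Omega> \<Longrightarrow> inner g (abs_L2 \<psi>) = 0"
  shows "g = 0"
  using assms(2,3)
proof (induction g rule: L2.abs_induct)
  case (1 f)
  then have f: "square_integrable f" by (simp add: l2_rel_refl_iff)
  have "AE x in lborel. x \<in> \<Omega> \<longrightarrow> f x = 0"
  proof (rule fundamental_lemma_of_variations[OF \<open>open \<Omega>\<close> f])
    fix \<psi> assume "\<psi> \<in> test_functions \<Omega>"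
    with 1(3)[OF this] show "(\<integral>x. f x * \<psi> x \<partial>lborel) = 0"
      using inner_L2_abs[OF f square_integrable_test_function] by simp
  qed
  moreover have "AE x in lborel. x \<notin> \<Omega> \<longrightarrow> f x = 0"
    using 1(1,2) by (simp add: L2_on_def zero_outside.abs_eq)
  ultimately have "AE x in lborel. f x * f x = 0"
    by eventually_elim auto
  then have "(\<integral>x. f x * f x \<partial>lborel) = 0"
    by (rule integral_eq_zero_AE)
  then show ?case
    using inner_L2_abs[OF f f] inner_eq_zero_iff by metis
qed

section \<open>Uniqueness and linearity of weak derivatives\<close>

lemma subspace_L2_on: "subspace (L2_on \<Omega>)"
proof (rule subspaceI)
  show "0 \<in> L2_on \<Omega>"
    unfolding L2_on_def mem_Collect_eq by transfer simp
  show "u + v \<in> L2_on \<Omega>" if "u \<in> L2_on \<Omega>" "v \<in> L2_on \<Omega>" for u v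
    using that unfolding L2_on_def mem_Collect_eq
    by transfer (auto elim: AE_mp)
  show "c *\<^sub>R v \<in> L2_on \<Omega>" if "v \<in> L2_on \<Omega>" for c v
    using that unfolding L2_on_def mem_Collect_eq
    by transfer (auto elim: AE_mp)
qed

lemma is_weak_partial_unique:
  assumes "open \<Omega>" "is_weak_partial \<Omega> v i g" "is_weak_partial \<Omega> v i g'"
  shows "g = g'"
proof -
  have "g - g' = 0"
    using assms subspace_diff[OF subspace_L2_on]
    by (intro L2_on_eq_0I[OF \<open>open \<Omega>\<close>]) (auto simp: is_weak_partial_def inner_diff_left)
  then show ?thesis by simp
qed

lemma weak_partial_eqI:
  assumes "open \<Omega>" "is_weak_partial \<Omega> v i g"
  shows "weak_partial \<Omega> v i = g"
  unfolding weak_partial_def using assms is_weak_partial_unique by blast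

lemma is_weak_partial_weak_partial:
  assumes "open \<Omega>" "v \<in> H1 \<Omega>" "i \<in> Basis"
  shows "is_weak_partial \<Omega> v i (weak_partial \<Omega> v i)"
  using assms weak_partial_eqI[OF assms(1)] by (fastforce simp: H1_def)

lemma is_weak_partial_0: "is_weak_partial \<Omega> 0 i 0"
  by (simp add: is_weak_partial_def subspace_0[OF subspace_L2_on])

lemma is_weak_partial_add:
  "is_weak_partial \<Omega> v i g \<Longrightarrow> is_weak_partial \<Omega> w i h \<Longrightarrow> is_weak_partial \<Omega> (v + w) i (g + h)"
  by (simp add: is_weak_partial_def subspace_add[OF subspace_L2_on] inner_add_left)

lemma is_weak_partial_scaleR:
  "is_weak_partial \<Omega> v i g \<Longrightarrow> is_weak_partial \<Omega> (c *\<^sub>R v) i (c *\<^sub>R g)"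
  by (simp add: is_weak_partial_def subspace_scale[OF subspace_L2_on])

lemma subspace_H1: "subspace (H1 \<Omega>)"
proof (rule subspaceI)
  show "0 \<in> H1 \<Omega>"
    using is_weak_partial_0 subspace_0[OF subspace_L2_on] unfolding H1_def by blast
  show "v + w \<in> H1 \<Omega>" if "v \<in> H1 \<Omega>" "w \<in> H1 \<Omega>" for v w
    using that is_weak_partial_add subspace_add[OF subspace_L2_on] unfolding H1_def by blast
  show "c *\<^sub>R v \<in> H1 \<Omega>" if "v \<in> H1 \<Omega>" for c v
    using that is_weak_partial_scaleR subspace_scale[OF subspace_L2_on] unfolding H1_def by blast
qed

lemma weak_partial_add:
  assumes "open \<Omega>" "v \<in> H1 \<Omega>" "w \<in> H1 \<Omega>" "i \<in> Basis"
  shows "weak_partial \<Omega> (v + w) i = weak_partial \<Omega> v i + weak_partial \<Omega> w i"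
  using assms by (intro weak_partial_eqI is_weak_partial_add is_weak_partial_weak_partial)

lemma weak_partial_scaleR:
  assumes "open \<Omega>" "v \<in> H1 \<Omega>" "i \<in> Basis"
  shows "weak_partial \<Omega> (c *\<^sub>R v) i = c *\<^sub>R weak_partial \<Omega> v i"
  using assms by (intro weak_partial_eqI is_weak_partial_scaleR is_weak_partial_weak_partial)

lemma weak_partial_0: "open \<Omega> \<Longrightarrow> weak_partial \<Omega> 0 i = 0"
  by (intro weak_partial_eqI is_weak_partial_0)

section \<open>The Dirichlet form on \<open>H1 \<Omega>\<close>\<close>

lemma grad_inner_commute: "grad_inner \<Omega> v w = grad_inner \<Omega> w v"
  by (simp add: grad_inner_def inner_commute)

lemma grad_inner_nonneg: "0 \<le> grad_inner \<Omega> v v"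
  by (simp add: grad_inner_def sum_nonneg)

lemma grad_inner_0_right: "open \<Omega> \<Longrightarrow> grad_inner \<Omega> v 0 = 0"
  by (simp add: grad_inner_def weak_partial_0)

lemma grad_inner_add_right:
  assumes "open \<Omega>" "v \<in> H1 \<Omega>" "w \<in> H1 \<Omega>"
  shows "grad_inner \<Omega> u (v + w) = grad_inner \<Omega> u v + grad_inner \<Omega> u w"
  using assms by (simp add: grad_inner_def weak_partial_add inner_add_right sum.distrib)

lemma grad_inner_scaleR_right:
  assumes "open \<Omega>" "v \<in> H1 \<Omega>"
  shows "grad_inner \<Omega> u (c *\<^sub>R v) = c * grad_inner \<Omega> u v"
  using assms by (simp add: grad_inner_def weak_partial_scaleR sum_distrib_left)

lemma grad_inner_add_left:
  assumes "open \<Omega>" "v \<in> H1 \<Omega>" "w \<in> H1 \<Omega>"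
  shows "grad_inner \<Omega> (v + w) u = grad_inner \<Omega> v u + grad_inner \<Omega> w u"
  using grad_inner_add_right[OF assms] by (simp add: grad_inner_commute[of _ _ u])

lemma grad_inner_diff_left:
  assumes "open \<Omega>" "v \<in> H1 \<Omega>" "w \<in> H1 \<Omega>"
  shows "grad_inner \<Omega> (v - w) u = grad_inner \<Omega> v u - grad_inner \<Omega> w u"
  using grad_inner_add_left[OF assms(1) subspace_diff[OF subspace_H1 assms(2,3)] assms(3), of u]
  by simp

section \<open>The POD space and the energy estimate\<close>

text \<open>Passes from families to sets. Two distinct indices with the same vector would have inner
  product both 0 and 1, so injectivity is automatic.\<close>

lemma orthonormal_family_iff:
  "orthonormal_family r \<phi> \<longleftrightarrow> inj_on \<phi> {1..r} \<and> orthonormal (\<phi> ` {1..r})"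
proof
  assume o: "orthonormal_family r \<phi>"
  have "inj_on \<phi> {1..r}"
  proof (rule inj_onI)
    fix i j assume ij: "i \<in> {1..r}" "j \<in> {1..r}" "\<phi> i = \<phi> j"
    then have "\<phi> i \<bullet> \<phi> j = 1"
      using o unfolding orthonormal_family_def by metis
    then show "i = j"
      using o ij(1,2) unfolding orthonormal_family_def by (metis zero_neq_one)
  qed
  moreover from this have "orthonormal (\<phi> ` {1..r})"
    using o unfolding orthonormal_family_def orthonormal_def ball_simps by (auto simp: inj_on_eq_iff)
  ultimately show "inj_on \<phi> {1..r} \<and> orthonormal (\<phi> ` {1..r})" ..
next
  assume "inj_on \<phi> {1..r} \<and> orthonormal (\<phi> ` {1..r})"
  then show "orthonormal_family r \<phi>"
    unfolding orthonormal_family_def orthonormal_def by (auto simp: inj_on_eq_iff)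
qed

lemma POD_error_eq_orth_proj:
  assumes "inj_on \<phi> {1..r}"
  shows "POD_error M s r \<phi> =
    1 / real M * (\<Sum>i=1..M. (norm (s i - orth_proj (\<phi> ` {1..r}) (s i)))\<^sup>2)"
  unfolding POD_error_def orth_proj_def sum.reindex[OF assms] comp_def ..

text \<open>Orthonormal sets in the snapshot span lie in \<open>L2_on \<Omega>\<close>; once
  enumerated by \<open>{1..r}\<close> they are admissible competitors, so the abstract minimiser
  result applies.\<close>

lemma POD_basis_in_snapshot_span:
  assumes POD: "is_POD_basis \<Omega> M s r \<phi>" and "M > 0"
    and s: "s ` {1..M} \<subseteq> L2_on \<Omega>" and r: "r \<le> dim (span (s ` {1..M}))"
  shows "\<phi> ` {1..r} \<subseteq> span (s ` {1..M})"
proof (rule projection_error_minimiser_in_span)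
  have inj: "inj_on \<phi> {1..r}" and "orthonormal (\<phi> ` {1..r})"
    using POD unfolding is_POD_basis_def orthonormal_family_iff by blast+
  then show "orthonormal (\<phi> ` {1..r})" by blast
  have card: "card (\<phi> ` {1..r}) = r"
    using card_image[OF inj] by simp
  then show "card (\<phi> ` {1..r}) \<le> dim (span (s ` {1..M}))"
    using r by simp
  fix C assume C: "finite C" "orthonormal C" "C \<subseteq> span (s ` {1..M})" "card C = card (\<phi> ` {1..r})"
  obtain \<psi> where \<psi>: "bij_betw \<psi> {1..r} C"
    using ex_bij_betw_nat_finite_1[OF C(1)] C(4) card by auto
  then have im: "\<psi> ` {1..r} = C" and inj': "inj_on \<psi> {1..r}"
    by (auto simp: bij_betw_def)
  have "span (s ` {1..M}) \<subseteq> L2_on \<Omega>"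
    using s subspace_L2_on by (rule span_minimal)
  then have "POD_error M s r \<phi> \<le> POD_error M s r \<psi>"
    using POD C(2,3) im inj' unfolding is_POD_basis_def orthonormal_family_iff by blast
  then show "(\<Sum>i=1..M. (norm (s i - orth_proj (\<phi> ` {1..r}) (s i)))\<^sup>2) \<le>
      (\<Sum>i=1..M. (norm (s i - orth_proj C (s i)))\<^sup>2)"
    using \<open>M > 0\<close> unfolding POD_error_eq_orth_proj[OF inj] POD_error_eq_orth_proj[OF inj'] im
    by (simp add: divide_le_cancel)
qed simp_all

lemma H10_subset_H1: "H10 \<Omega> \<subseteq> H1 \<Omega>"
  by (auto simp: H10_def)

lemma H1_subset_L2_on: "H1 \<Omega> \<subseteq> L2_on \<Omega>"
  by (auto simp: H1_def)

text \<open>Every partial sum is kept in \<open>H1 \<Omega>\<close>, where additivity of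
  \<open>weak_partial\<close> has been established.\<close>

lemma grad_inner_sum_right:
  assumes "open \<Omega>" "finite B" "B \<subseteq> H1 \<Omega>"
  shows "grad_inner \<Omega> u (\<Sum>b\<in>B. c b *\<^sub>R b) = (\<Sum>b\<in>B. c b * grad_inner \<Omega> u b)"
  using assms(2,3)
proof (induction B rule: finite_induct)
  case empty
  show ?case using assms(1) by (simp add: grad_inner_0_right)
next
  case (insert b B)
  have "(\<Sum>b\<in>B. c b *\<^sub>R b) \<in> H1 \<Omega>"
    using insert.prems by (intro subspace_sum subspace_scale subspace_H1) auto
  moreover have "c b *\<^sub>R b \<in> H1 \<Omega>"
    using insert.prems by (intro subspace_scale subspace_H1) auto
  ultimately show ?case
    using insert assms(1) by (simp add: grad_inner_add_right grad_inner_scaleR_right)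
qed

text \<open>Expand the square of the difference for each partial derivative and sum over the
  directions.\<close>

lemma grad_inner_le_half_sum_squares:
  "2 * grad_inner \<Omega> v w \<le> grad_inner \<Omega> v v + grad_inner \<Omega> w w"
proof -
  have "2 * (x \<bullet> y) \<le> x \<bullet> x + y \<bullet> y" for x y :: "'a L2"
    using inner_ge_zero[of "x - y"]
    by (simp add: inner_diff_left inner_diff_right inner_commute[of y x])
  then show ?thesis
    unfolding grad_inner_def sum_distrib_left sum.distrib[symmetric] by (intro sum_mono)
qed

lemma grad_norm_squared: "(grad_norm \<Omega> v)\<^sup>2 = grad_inner \<Omega> v v"
  by (simp add: grad_norm_def grad_inner_nonneg)

text \<open>Testing with linear combinations of elements of \<open>H10 \<Omega>\<close>, rather than with elements of its span
  shown to lie in \<open>H10 \<Omega>\<close>, avoids having to prove that \<open>H10 \<Omega>\<close> is a subspace, for which one would need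
  that test functions have weak derivatives.\<close>

lemma heat_weak_solution_test_span:
  assumes "open \<Omega>" and u: "heat_weak_solution \<Omega> T \<nu> f u"
    and "S \<subseteq> H10 \<Omega>" "v \<in> span S" and t: "t \<in> {0..T}"
  shows "\<exists>D. ((\<lambda>s. u s \<bullet> v) has_real_derivative D) (at t within {0..T}) \<and>
    D + \<nu> * grad_inner \<Omega> (u t) v = f t \<bullet> v"
proof -
  let ?P = "\<lambda>v. \<exists>D. ((\<lambda>s. u s \<bullet> v) has_real_derivative D) (at t within {0..T}) \<and>
    D + \<nu> * grad_inner \<Omega> (u t) v = f t \<bullet> v"
  have S: "S \<subseteq> H1 \<Omega>"
    using assms(3) H10_subset_H1 by blast
  have "v \<in> H1 \<Omega> \<and> ?P v"
    using \<open>v \<in> span S\<close>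
  proof (induction v rule: span_induct_alt)
    case base
    have "?P 0"
      using grad_inner_0_right[OF \<open>open \<Omega>\<close>] by (intro exI[of _ 0]) simp
    then show ?case using subspace_0[OF subspace_H1] by blast
  next
    case (step c x y)
    then have x: "x \<in> H1 \<Omega>" and y: "y \<in> H1 \<Omega>" using S by auto
    have cx: "c *\<^sub>R x \<in> H1 \<Omega>" using x by (rule subspace_scale[OF subspace_H1])
    have "?P x"
      using u t step(1) assms(3) unfolding heat_solution_in_def by blast
    then obtain D where D: "((\<lambda>s. u s \<bullet> x) has_real_derivative D) (at t within {0..T})"
        "D + \<nu> * grad_inner \<Omega> (u t) x = f t \<bullet> x" by blast
    from step obtain E where E: "((\<lambda>s. u s \<bullet> y) has_real_derivative E) (at t within {0..T})"
        "E + \<nu> * grad_inner \<Omega> (u t) y = f t \<bullet> y" by blast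
    have "((\<lambda>s. u s \<bullet> (c *\<^sub>R x + y)) has_real_derivative c * D + E) (at t within {0..T})"
      unfolding inner_add_right inner_scaleR_right by (intro DERIV_add DERIV_cmult D(1) E(1))
    moreover have "c * D + E + \<nu> * grad_inner \<Omega> (u t) (c *\<^sub>R x + y) = f t \<bullet> (c *\<^sub>R x + y)"
    proof -
      have "c * D + E + \<nu> * grad_inner \<Omega> (u t) (c *\<^sub>R x + y) =
          c * (D + \<nu> * grad_inner \<Omega> (u t) x) + (E + \<nu> * grad_inner \<Omega> (u t) y)"
        using grad_inner_add_right[OF \<open>open \<Omega>\<close> cx y] grad_inner_scaleR_right[OF \<open>open \<Omega>\<close> x]
        by (simp add: distrib_left)
      then show ?thesis
        by (simp only: D(2) E(2) inner_add_right inner_scaleR_right)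
    qed
    ultimately have "?P (c *\<^sub>R x + y)" by blast
    then show ?case
      using subspace_add[OF subspace_H1 cx y] by blast
  qed
  then show ?thesis ..
qed

theorem mainTheorem3:
  fixes \<Omega> :: "'a::euclidean_space set"
    and \<nu> T :: real
    and f u u\<^sub>r \<eta> \<phi>\<^sub>r :: "real \<Rightarrow> 'a L2"
    and N r :: nat
    and \<tau> :: "nat \<Rightarrow> real"
    and s \<phi> :: "nat \<Rightarrow> 'a L2"
    and V X\<^sub>r :: "'a L2 set"
  assumes "open \<Omega>" and "\<nu> > 0" and "T > 0"
    and "\<And>t. t \<in> {0..T} \<Longrightarrow> f t \<in> L2_on \<Omega>"
    and "heat_weak_solution \<Omega> T \<nu> f u"
    and "\<And>i. i \<in> {0..N} \<Longrightarrow> \<tau> i \<in> {0..T}"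
    and "\<And>i. i \<in> {1..N + 1} \<Longrightarrow> s i = u (\<tau> (i - 1))"
    and "V = span (s ` {1..N + 1})"
    and "r \<le> dim V"
    and "is_POD_basis \<Omega> (N + 1) s r \<phi>"
    and "X\<^sub>r = span (\<phi> ` {1..r})"
    and "heat_solution_in X\<^sub>r \<Omega> T \<nu> f u\<^sub>r"
    and "\<And>t. t \<in> {0..T} \<Longrightarrow> \<eta> t = u t - L2_projection X\<^sub>r (u t)"
    and "\<And>t. t \<in> {0..T} \<Longrightarrow> \<phi>\<^sub>r t = u\<^sub>r t - L2_projection X\<^sub>r (u t)"
  shows "\<forall>t\<in>{0..T}. \<exists>D.
    ((\<lambda>t'. (norm (\<phi>\<^sub>r t'))\<^sup>2) has_real_derivative D) (at t within {0..T}) \<and>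
    D \<le> \<nu> * (grad_norm \<Omega> (\<eta> t))\<^sup>2"
proof
  fix t assume t: "t \<in> {0..T}"
  note u = assms(5) and u\<^sub>r = assms(12)
  define B where "B = \<phi> ` {1..r}"
  let ?w = "\<phi>\<^sub>r t" and ?G = "grad_inner \<Omega>"
  have X: "X\<^sub>r = span B" by (simp add: assms(11) B_def)
  have uH: "u t' \<in> H10 \<Omega>" if "t' \<in> {0..T}" for t'
    using u that unfolding heat_solution_in_def by blast
  \<comment> \<open>Snapshots are numbered from 1, time instances from 0.\<close>
  have "\<tau> (i - 1) \<in> {0..T}" if "i \<in> {1..N + 1}" for i
    using that by (intro assms(6)) auto
  then have sH: "s ` {1..N + 1} \<subseteq> H10 \<Omega>"
    using assms(7) uH by auto
  have BV: "B \<subseteq> span (s ` {1..N + 1})"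
    unfolding B_def
  proof (rule POD_basis_in_snapshot_span[OF assms(10)])
    show "s ` {1..N + 1} \<subseteq> L2_on \<Omega>"
      using sH H10_subset_H1 H1_subset_L2_on by blast
    show "r \<le> dim (span (s ` {1..N + 1}))"
      using assms(8,9) by simp
  qed simp
  have B: "finite B" "orthonormal B"
    using assms(10) unfolding is_POD_basis_def orthonormal_family_iff B_def by auto
  have XV: "span B \<subseteq> span (s ` {1..N + 1})"
    using BV subspace_span by (rule span_minimal)
  have VH1: "span (s ` {1..N + 1}) \<subseteq> H1 \<Omega>"
    using sH H10_subset_H1 subspace_H1 by (intro span_minimal) auto
  have BH1: "B \<subseteq> H1 \<Omega>"
    using BV VH1 by blast
  have proj: "L2_projection X\<^sub>r x = orth_proj B x" for x
    unfolding X using B by (rule L2_projection_eq_orth_proj)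
  have urX: "u\<^sub>r t' \<in> span B" if "t' \<in> {0..T}" for t'
    using u\<^sub>r that unfolding heat_solution_in_def X by blast
  have wX: "\<phi>\<^sub>r t' \<in> span B" if "t' \<in> {0..T}" for t'
    unfolding assms(14)[OF that] proj using urX[OF that] orth_proj_in_span by (rule span_diff)
  have wH1: "?w \<in> H1 \<Omega>"
    using wX[OF t] XV VH1 by blast
  have \<eta>H1: "\<eta> t \<in> H1 \<Omega>"
    unfolding assms(13)[OF t] proj
    using uH[OF t] H10_subset_H1 orth_proj_in_span[of B "u t"] XV VH1
    by (intro subspace_diff subspace_H1) auto

  \<comment> \<open>Against elements of \<open>B\<close> the projection of \<open>u t'\<close> may
    be replaced by \<open>u t'\<close> itself, so no derivative of the projection is needed.\<close>
  have inner_w: "\<phi>\<^sub>r t' \<bullet> b = u\<^sub>r t' \<bullet> b - u t' \<bullet> b" if "t' \<in> {0..T}" "b \<in> B" for t' b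
    using orth_proj_residual[OF B span_base[OF that(2)], of "u t'"]
    unfolding assms(14)[OF that(1)] proj by (simp add: inner_diff_left)
  have grad: "?G (u\<^sub>r t) b - ?G (u t) b = ?G ?w b - ?G (\<eta> t) b" for b
  proof -
    have "u\<^sub>r t - u t = ?w - \<eta> t"
      using t by (simp add: assms(13,14))
    moreover have "u\<^sub>r t \<in> H1 \<Omega>" "u t \<in> H1 \<Omega>"
      using urX[OF t] XV VH1 uH[OF t] H10_subset_H1 by auto
    ultimately show ?thesis
      using grad_inner_diff_left[OF assms(1)] wH1 \<eta>H1 by metis
  qed
  have deriv: "((\<lambda>t'. \<phi>\<^sub>r t' \<bullet> b) has_real_derivative - \<nu> * (?G ?w b - ?G (\<eta> t) b))
      (at t within {0..T})" if b: "b \<in> B" for b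
  proof -
    obtain D where D: "((\<lambda>t'. u t' \<bullet> b) has_real_derivative D) (at t within {0..T})"
        "D + \<nu> * ?G (u t) b = f t \<bullet> b"
      using heat_weak_solution_test_span[OF assms(1) u sH _ t] b BV by blast
    obtain D\<^sub>r where D\<^sub>r: "((\<lambda>t'. u\<^sub>r t' \<bullet> b) has_real_derivative D\<^sub>r) (at t within {0..T})"
        "D\<^sub>r + \<nu> * ?G (u\<^sub>r t) b = f t \<bullet> b"
      using u\<^sub>r t span_base[OF b] unfolding heat_solution_in_def X by blast
    have "D\<^sub>r - D = - \<nu> * (?G (u\<^sub>r t) b - ?G (u t) b)"
      using D(2) D\<^sub>r(2) by (simp add: right_diff_distrib)
    then have "((\<lambda>t'. u\<^sub>r t' \<bullet> b - u t' \<bullet> b) has_real_derivative - \<nu> * (?G ?w b - ?G (\<eta> t) b))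
        (at t within {0..T})"
      using DERIV_diff[OF D\<^sub>r(1) D(1)] grad by simp
    \<comment> \<open>The identity \<open>inner_w\<close> is available only on
      \<open>{0..T}\<close>, so the derivative is transferred within that interval; the radius 1 is
      arbitrary.\<close>
    then show ?thesis
      by (rule has_field_derivative_transform_within[OF _ zero_less_one t]) (use inner_w b in auto)
  qed
  \<comment> \<open>By Parseval the squared norm is a finite sum of squared coordinates. Each
    coordinate is differentiable, so \<open>u\<close> need not be differentiable as a curve in
    \<open>L2\<close>.\<close>
  let ?D = "\<Sum>b\<in>B. 2 * (?w \<bullet> b) * (- \<nu> * (?G ?w b - ?G (\<eta> t) b))"
  have "((\<lambda>t'. \<Sum>b\<in>B. (\<phi>\<^sub>r t' \<bullet> b)\<^sup>2) has_real_derivative ?D) (at t within {0..T})"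
  proof (rule DERIV_sum)
    fix b assume "b \<in> B"
    from DERIV_power[OF deriv[OF this], of 2]
    show "((\<lambda>t'. (\<phi>\<^sub>r t' \<bullet> b)\<^sup>2) has_real_derivative
        2 * (?w \<bullet> b) * (- \<nu> * (?G ?w b - ?G (\<eta> t) b))) (at t within {0..T})"
      by (simp add: mult_ac)
  qed
  then have "((\<lambda>t'. (norm (\<phi>\<^sub>r t'))\<^sup>2) has_real_derivative ?D) (at t within {0..T})"
    by (rule has_field_derivative_transform_within[OF _ zero_less_one t])
      (use norm_sq_eq_sum_inner[OF B wX] in auto)
  moreover have "?D \<le> \<nu> * (grad_norm \<Omega> (\<eta> t))\<^sup>2"
  proof -
    \<comment> \<open>Recombines the coordinates into \<open>?w\<close>: this is testing with
      \<open>?w\<close> itself.\<close>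
    have G: "(\<Sum>b\<in>B. (?w \<bullet> b) * ?G x b) = ?G x ?w" for x
      using grad_inner_sum_right[OF assms(1) B(1) BH1, of x "\<lambda>b. ?w \<bullet> b"]
        orth_proj_fix[OF B wX[OF t]] by (simp add: orth_proj_def)
    have "?D = 2 * \<nu> * ((\<Sum>b\<in>B. (?w \<bullet> b) * ?G (\<eta> t) b) - (\<Sum>b\<in>B. (?w \<bullet> b) * ?G ?w b))"
      unfolding sum_subtractf[symmetric] sum_distrib_left
      by (intro sum.cong) (simp_all add: algebra_simps)
    also have "\<dots> = \<nu> * (2 * ?G (\<eta> t) ?w - 2 * ?G ?w ?w)"
      unfolding G by (simp add: algebra_simps)
    \<comment> \<open>Young's inequality absorbs one copy of \<open>?G ?w ?w\<close>; the other has
      a favourable sign and is discarded.\<close>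
    also have "\<dots> \<le> \<nu> * ?G (\<eta> t) (\<eta> t)"
      using grad_inner_le_half_sum_squares[of \<Omega> "\<eta> t" ?w] grad_inner_nonneg[of \<Omega> ?w] assms(2)
      by (intro mult_left_mono) auto
    finally show ?thesis by (simp add: grad_norm_squared)
  qed
  ultimately show "\<exists>D. ((\<lambda>t'. (norm (\<phi>\<^sub>r t'))\<^sup>2) has_real_derivative D) (at t within {0..T}) \<and>
      D \<le> \<nu> * (grad_norm \<Omega> (\<eta> t))\<^sup>2"
    by blast
qed

end
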